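(* Let $n\ge 1$, let $U\subseteq\mathbb{R}^n$ be open, let $I\subseteq\mathbb{R}$ be an open interval, and let $V:U\times I\to\mathbb{R}$ and $f:I\to\mathbb{R}$ be smooth. Then the second-order system $$\ddot q^a+\frac{\partial V(q,t)}{\partial q^a}+f(t)\,\dot q^a=0,\qquad a=1,\dots,n,$$ corresponds to the flow of the contact Hamiltonian $$\mathcal{H}(q,p,s,t)=\sum_{a=1}^n\frac{p_a^2}{2}+V(q,t)+f(t)\,s$$ on $U\times\mathbb{R}^n\times\mathbb{R}$ with coordinates $(q^a,p_a,s)$ and contact form $\eta=\mathrm{d}s-\sum_a p_a\,\mathrm{d}q^a$, in the following sense: a smooth curve $q:J\to U$ on an open interval $J\subseteq I$ solves the second-order system if and only if there exist smooth curves $p:J\to\mathbb{R}^n$ and $s:J\to\mathbb{R}$ such that $(q(t),p(t),s(t))$ solves the contact Hamiltonian equations of $\mathcal{H}$.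
   Context: For a (possibly time-dependent) function $\mathcal{H}(q,p,s,t)$ on an exact contact manifold with fixed contact form $\eta$, the contact Hamiltonian vector field $X_{\mathcal{H}}$ is the vector field determined (at each fixed $t$) by $\mathcal{L}_{X_{\mathcal{H}}}\eta=\rho\,\eta$ for some function $\rho$ and $\iota_{X_{\mathcal{H}}}\eta=-\mathcal{H}$ (here $\mathcal{L}$ is the Lie derivative and $\iota$ the interior product). In coordinates $(q^a,p_a,s)$ with $\eta=\mathrm{d}s-\sum_a p_a\,\mathrm{d}q^a$, the contact Hamiltonian equations (the integral curves of $X_{\mathcal{H}}$, with $t$ as time) are $$\dot q^a=\frac{\partial\mathcal{H}}{\partial p_a},\qquad \dot p_a=-\frac{\partial\mathcal{H}}{\partial q^a}-p_a\frac{\partial\mathcal{H}}{\partial s},\qquad \dot s=\sum_a p_a\frac{\partial\mathcal{H}}{\partial p_a}-\mathcal{H}.$$ *)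

theory Defs
  imports "HOL-Analysis.Analysis"
begin

text \<open>
  \<open>k\<close> times continuously differentiable on \<open>S\<close>, by iterating directional derivatives.
  The derivatives are two-sided, so this is meant for open \<open>S\<close>.
\<close>

fun C_on :: "nat \<Rightarrow> 'a::real_normed_vector set \<Rightarrow> ('a \<Rightarrow> 'b::real_normed_vector) \<Rightarrow> bool" where
  "C_on 0 S f \<longleftrightarrow> continuous_on S f"
| "C_on (Suc k) S f \<longleftrightarrow>
     (\<forall>x\<in>S. f differentiable (at x)) \<and> (\<forall>v. C_on k S (\<lambda>x. frechet_derivative f (at x) v))"

definition smooth_on :: "'a::real_normed_vector set \<Rightarrow> ('a \<Rightarrow> 'b::real_normed_vector) \<Rightarrow> bool" where
  "smooth_on S f \<longleftrightarrow> (\<forall>k. C_on k S f)"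

definition partial_deriv :: "'n::finite \<Rightarrow> (real^'n \<Rightarrow> real) \<Rightarrow> real^'n \<Rightarrow> real" where
  "partial_deriv a F x = deriv (\<lambda>h. F (x + h *\<^sub>R axis a 1)) 0"

definition contact_hamilton_equations ::
  "real set \<Rightarrow> (real^'n::finite \<Rightarrow> real^'n \<Rightarrow> real \<Rightarrow> real \<Rightarrow> real) \<Rightarrow>
   (real \<Rightarrow> real^'n) \<Rightarrow> (real \<Rightarrow> real^'n) \<Rightarrow> (real \<Rightarrow> real) \<Rightarrow> bool" where
  "contact_hamilton_equations J H q p s \<longleftrightarrow>
    (\<forall>t\<in>J.
      (\<forall>a. ((\<lambda>\<tau>. q \<tau> $ a) has_real_derivative
             partial_deriv a (\<lambda>y. H (q t) y (s t) t) (p t)) (at t)) \<and>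
      (\<forall>a. ((\<lambda>\<tau>. p \<tau> $ a) has_real_derivative
             - partial_deriv a (\<lambda>x. H x (p t) (s t) t) (q t)
             - p t $ a * deriv (\<lambda>z. H (q t) (p t) z t) (s t)) (at t)) \<and>
      (s has_real_derivative
        (\<Sum>a\<in>UNIV. p t $ a * partial_deriv a (\<lambda>y. H (q t) y (s t) t) (p t))
        - H (q t) (p t) (s t) t) (at t))"

text \<open>
  The rest relates these equations to the contact form \<open>ds - \<Sum>\<^sub>a p\<^sub>a dq\<^sup>a\<close>: they are the
  equations for integral curves of the vector field \<open>X\<close> given by \<open>L\<^sub>X \<eta> = \<rho> \<eta>\<close> and
  \<open>\<iota>\<^sub>X \<eta> = - H\<close>. Points and tangent vectors are triples ordered as \<open>(q, p, s)\<close>.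
\<close>

definition contact_form ::
  "(real^'n::finite) \<times> (real^'n) \<times> real \<Rightarrow> (real^'n) \<times> (real^'n) \<times> real \<Rightarrow> real" where
  "contact_form = (\<lambda>(q, p, s) (v, w, z). z - (\<Sum>a\<in>UNIV. p $ a * v $ a))"

text \<open>Lie derivative of a one-form on a vector space:
  \<open>(L\<^sub>X \<alpha>)\<^sub>x(v) = (D\<alpha>\<^sub>x(X\<^sub>x))(v) + \<alpha>\<^sub>x(DX\<^sub>x(v))\<close>.\<close>

definition lie_derivative_form ::
  "('a::real_normed_vector \<Rightarrow> 'a) \<Rightarrow> ('a \<Rightarrow> 'a \<Rightarrow> real) \<Rightarrow> 'a \<Rightarrow> 'a \<Rightarrow> real" where
  "lie_derivative_form X \<alpha> x v =
     frechet_derivative (\<lambda>y. \<alpha> y v) (at x) (X x) + \<alpha> x (frechet_derivative X (at x) v)"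

definition contact_hamiltonian_field ::
  "((real^'n::finite) \<times> (real^'n) \<times> real) set \<Rightarrow> ((real^'n) \<times> (real^'n) \<times> real \<Rightarrow> real) \<Rightarrow>
   ((real^'n) \<times> (real^'n) \<times> real \<Rightarrow> (real^'n) \<times> (real^'n) \<times> real) \<Rightarrow> bool" where
  "contact_hamiltonian_field M h X \<longleftrightarrow>
     (\<exists>\<rho>. \<forall>x\<in>M. \<forall>v. lie_derivative_form X contact_form x v = \<rho> x * contact_form x v) \<and>
     (\<forall>x\<in>M. contact_form x (X x) = - h x)"

lemma contact_form_eq: "contact_form x v = snd (snd v) - fst (snd x) \<bullet> fst v"
  by (simp add: contact_form_def inner_vec_def split: prod.splits)

lemma deriv_along:
  assumes "(F has_derivative F') (at x)"
  shows "deriv (\<lambda>h. F (x + h *\<^sub>R v)) 0 = (F' v :: real)"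
proof -
  have F: "(F has_derivative F') (at (x + 0 *\<^sub>R v))" using assms by simp
  have "((\<lambda>h. x + h *\<^sub>R v) has_derivative (\<lambda>h. h *\<^sub>R v)) (at 0)"
    by (auto intro!: derivative_eq_intros)
  from diff_chain_at[OF this F]
  have "((\<lambda>h. F (x + h *\<^sub>R v)) has_derivative (\<lambda>h. F' (h *\<^sub>R v))) (at 0)"
    by (simp add: o_def)
  moreover have "(\<lambda>h. F' (h *\<^sub>R v)) = (*) (F' v)"
    using linear_simps(5)[OF has_derivative_bounded_linear[OF assms]] by (auto simp: mult.commute)
  ultimately show ?thesis by (intro DERIV_imp_deriv) (simp add: has_field_derivative_def)
qed

lemma partial_derivs_eq:
  fixes h :: "(real^'n::finite) \<times> (real^'n) \<times> real \<Rightarrow> real"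
  assumes h: "(h has_derivative D) (at (q, p, s))"
  shows "partial_deriv a (\<lambda>x. h (x, p, s)) q = D (axis a 1, 0, 0)"
    and "partial_deriv a (\<lambda>y. h (q, y, s)) p = D (0, axis a 1, 0)"
    and "deriv (\<lambda>z. h (q, p, z)) s = D (0, 0, 1)"
proof -
  show "partial_deriv a (\<lambda>x. h (x, p, s)) q = D (axis a 1, 0, 0)"
    using deriv_along[OF h, of "(axis a 1, 0, 0)"] by (simp add: partial_deriv_def)
  show "partial_deriv a (\<lambda>y. h (q, y, s)) p = D (0, axis a 1, 0)"
    using deriv_along[OF h, of "(0, axis a 1, 0)"] by (simp add: partial_deriv_def)
  have "((\<lambda>z. (q, p, z)) has_derivative (\<lambda>z. (0, 0, z))) (at s)"
    by (auto intro!: derivative_eq_intros)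
  from diff_chain_at[OF this h]
  have "((\<lambda>z. h (q, p, z)) has_derivative (\<lambda>z. D (0, 0, z))) (at s)"
    by (simp add: o_def)
  moreover have "(\<lambda>z. D (0, 0, z)) = (*) (D (0, 0, 1))"
  proof
    fix z :: real
    show "D (0, 0, z) = D (0, 0, 1) * z"
      using linear_simps(5)[OF has_derivative_bounded_linear[OF h], of z "(0, 0, 1)"]
      by (simp add: mult.commute)
  qed
  ultimately show "deriv (\<lambda>z. h (q, p, z)) s = D (0, 0, 1)"
    by (intro DERIV_imp_deriv) (simp add: has_field_derivative_def)
qed

lemma lie_derivative_contact_form:
  assumes X: "X differentiable (at x)"
  shows "lie_derivative_form X contact_form x v =
    snd (snd (frechet_derivative X (at x) v)) - fst (snd x) \<bullet> fst (frechet_derivative X (at x) v)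
    - fst (snd (X x)) \<bullet> fst v"
proof -
  have "((\<lambda>y. contact_form y v) has_derivative (\<lambda>u. - (fst (snd u) \<bullet> fst v))) (at x)"
    unfolding contact_form_eq by (auto intro!: derivative_eq_intros)
  then show ?thesis
    by (simp add: lie_derivative_form_def frechet_derivative_at[symmetric] contact_form_eq)
qed

lemma contact_hamiltonian_field_iff:
  fixes h :: "(real^'n::finite) \<times> (real^'n) \<times> real \<Rightarrow> real"
  assumes M: "open M"
    and h: "\<And>x. x \<in> M \<Longrightarrow> h differentiable (at x)"
    and X: "\<And>x. x \<in> M \<Longrightarrow> X differentiable (at x)"
  shows "contact_hamiltonian_field M h X \<longleftrightarrow>
    (\<forall>(q, p, s)\<in>M. X (q, p, s) =
      (\<chi> a. partial_deriv a (\<lambda>y. h (q, y, s)) p,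
       \<chi> a. - partial_deriv a (\<lambda>x. h (x, p, s)) q - p $ a * deriv (\<lambda>z. h (q, p, z)) s,
       (\<Sum>a\<in>UNIV. p $ a * partial_deriv a (\<lambda>y. h (q, y, s)) p) - h (q, p, s)))"
proof -
  have key: "(\<exists>r. \<forall>v. lie_derivative_form X contact_form (q, p, s) v
                  = r * contact_form (q, p, s) v) \<longleftrightarrow>
      fst (X (q, p, s)) = (\<chi> a. partial_deriv a (\<lambda>y. h (q, y, s)) p) \<and>
      fst (snd (X (q, p, s))) =
        (\<chi> a. - partial_deriv a (\<lambda>x. h (x, p, s)) q - p $ a * deriv (\<lambda>z. h (q, p, z)) s)"
    if m: "(q, p, s) \<in> M"
      and C: "\<And>x. x \<in> M \<Longrightarrow> snd (snd (X x)) = fst (snd x) \<bullet> fst (X x) - h x" for q p s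
  proof -
    let ?x = "(q, p, s)"
    define D where "D = frechet_derivative h (at ?x)"
    define Y where "Y = frechet_derivative X (at ?x)"
    have D: "(h has_derivative D) (at ?x)" and Y: "(X has_derivative Y) (at ?x)"
      using h[OF m] X[OF m] unfolding D_def Y_def frechet_derivative_works .
    interpret D: bounded_linear D using D by (rule has_derivative_bounded_linear)
    have "((\<lambda>x. snd (snd (X x))) has_derivative (\<lambda>v. snd (snd (Y v)))) (at ?x)"
      by (intro derivative_intros Y)
    moreover have "((\<lambda>x. snd (snd (X x))) has_derivative
        (\<lambda>v. fst (snd v) \<bullet> fst (X ?x) + p \<bullet> fst (Y v) - D v)) (at ?x)"
    proof (rule has_derivative_transform_within_open[OF _ M m])
      show "((\<lambda>x. fst (snd x) \<bullet> fst (X x) - h x) has_derivative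
        (\<lambda>v. fst (snd v) \<bullet> fst (X ?x) + p \<bullet> fst (Y v) - D v)) (at ?x)"
        by (auto intro!: derivative_eq_intros Y D)
    qed (simp add: C)
    ultimately have YY: "(\<lambda>v. snd (snd (Y v))) =
        (\<lambda>v. fst (snd v) \<bullet> fst (X ?x) + p \<bullet> fst (Y v) - D v)"
      by (rule has_derivative_unique)
    have lie: "lie_derivative_form X contact_form ?x v =
        fst (snd v) \<bullet> fst (X ?x) - D v - fst (snd (X ?x)) \<bullet> fst v" for v
      unfolding lie_derivative_contact_form[OF X[OF m]] Y_def[symmetric]
      using fun_cong[OF YY, of v] by simp
    note pd = partial_derivs_eq[OF D]
    have D1: "D (v, 0, 0) = (\<Sum>a\<in>UNIV. v $ a * D (axis a 1, 0, 0))"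
      and D2: "D (0, v, 0) = (\<Sum>a\<in>UNIV. v $ a * D (0, axis a 1, 0))" for v
    proof -
      have v: "v = (\<Sum>a\<in>UNIV. v $ a *\<^sub>R axis a 1)"
        using basis_expansion[of v] by (simp add: scalar_mult_eq_scaleR)
      have "linear (\<lambda>v. D (v, 0, 0))" "linear (\<lambda>v. D (0, v, 0))"
        using D.add[of "(_, 0, 0)" "(_, 0, 0)"] D.scaleR[of _ "(_, 0, 0)"]
          D.add[of "(0, _, 0)" "(0, _, 0)"] D.scaleR[of _ "(0, _, 0)"]
        by (auto intro!: linearI)
      from linear_sum[OF this(1), of "\<lambda>a. v $ a *\<^sub>R axis a 1" UNIV]
        linear_sum[OF this(2), of "\<lambda>a. v $ a *\<^sub>R axis a 1" UNIV]
        linear_scale[OF this(1)] linear_scale[OF this(2)]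
      show "D (v, 0, 0) = (\<Sum>a\<in>UNIV. v $ a * D (axis a 1, 0, 0))"
        "D (0, v, 0) = (\<Sum>a\<in>UNIV. v $ a * D (0, axis a 1, 0))"
        using v by simp_all
    qed
    have D3: "D (0, 0, z) = z * D (0, 0, 1)" for z
      using D.scaleR[of z "(0, 0, 1)"] by simp
    have split: "D (v, w, z) = D (v, 0, 0) + D (0, w, 0) + D (0, 0, z)" for v w z
      using D.add[of "(v, 0, 0)" "(0, w, z)"] D.add[of "(0, w, 0)" "(0, 0, z)"] by simp
    show ?thesis
    proof
      assume "\<exists>r. \<forall>v. lie_derivative_form X contact_form ?x v = r * contact_form ?x v"
      then obtain r where r: "fst (snd v) \<bullet> fst (X ?x) - D v - fst (snd (X ?x)) \<bullet> fst v
          = r * (snd (snd v) - p \<bullet> fst v)" for v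
        unfolding lie contact_form_eq fst_conv snd_conv by blast
      have 1: "r = - D (0, 0, 1)" using r[of "(0, 0, 1)"] by simp
      have 2: "fst (X ?x) $ a = D (0, axis a 1, 0)" for a
        using r[of "(0, axis a 1, 0)"] by (simp add: inner_axis')
      have 3: "fst (snd (X ?x)) $ a = - D (axis a 1, 0, 0) - p $ a * D (0, 0, 1)" for a
        using r[of "(axis a 1, 0, 0)"] by (simp add: inner_axis 1 algebra_simps)
      show "fst (X ?x) = (\<chi> a. partial_deriv a (\<lambda>y. h (q, y, s)) p) \<and>
        fst (snd (X ?x)) =
        (\<chi> a. - partial_deriv a (\<lambda>x. h (x, p, s)) q - p $ a * deriv (\<lambda>z. h (q, p, z)) s)"
        by (simp add: vec_eq_iff pd 2 3)
    next
      assume "fst (X ?x) = (\<chi> a. partial_deriv a (\<lambda>y. h (q, y, s)) p) \<and>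
        fst (snd (X ?x)) =
        (\<chi> a. - partial_deriv a (\<lambda>x. h (x, p, s)) q - p $ a * deriv (\<lambda>z. h (q, p, z)) s)"
      then have A: "fst (X ?x) = (\<chi> a. D (0, axis a 1, 0))"
        and B: "fst (snd (X ?x)) = (\<chi> a. - D (axis a 1, 0, 0) - p $ a * D (0, 0, 1))"
        by (simp_all add: pd)
      have "lie_derivative_form X contact_form ?x v = - D (0, 0, 1) * contact_form ?x v" for v
      proof (cases v)
        case (fields v1 v2 v3)
        have "v2 \<bullet> fst (X ?x) = D (0, v2, 0)"
          unfolding D2[of v2] by (simp add: A inner_vec_def)
        moreover have "fst (snd (X ?x)) \<bullet> v1 = - D (v1, 0, 0) - D (0, 0, 1) * (p \<bullet> v1)"
          unfolding D1[of v1]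
          by (simp add: B inner_vec_def algebra_simps sum.distrib sum_negf
              sum_subtractf sum_distrib_left)
        ultimately show ?thesis
          by (simp add: fields lie contact_form_eq split[of v1 v2 v3] D3[of v3] algebra_simps)
      qed
      then show "\<exists>r. \<forall>v. lie_derivative_form X contact_form ?x v = r * contact_form ?x v"
        by blast
    qed
  qed
  have \<iota>: "contact_form x (X x) = - h x \<longleftrightarrow> snd (snd (X x)) = fst (snd x) \<bullet> fst (X x) - h x" for x
    by (auto simp: contact_form_eq)
  have \<rho>: "(\<exists>\<rho>. \<forall>x\<in>M. \<forall>v. lie_derivative_form X contact_form x v = \<rho> x * contact_form x v) \<longleftrightarrow>
      (\<forall>x\<in>M. \<exists>r. \<forall>v. lie_derivative_form X contact_form x v = r * contact_form x v)"
    by (rule bchoice_iff[symmetric])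
  show ?thesis
  proof
    assume "contact_hamiltonian_field M h X"
    then have L: "\<forall>x\<in>M. \<exists>r. \<forall>v. lie_derivative_form X contact_form x v = r * contact_form x v"
      and C: "\<And>x. x \<in> M \<Longrightarrow> snd (snd (X x)) = fst (snd x) \<bullet> fst (X x) - h x"
      unfolding contact_hamiltonian_field_def \<rho> \<iota> by blast+
    show "\<forall>(q, p, s)\<in>M. X (q, p, s) =
      (\<chi> a. partial_deriv a (\<lambda>y. h (q, y, s)) p,
       \<chi> a. - partial_deriv a (\<lambda>x. h (x, p, s)) q - p $ a * deriv (\<lambda>z. h (q, p, z)) s,
       (\<Sum>a\<in>UNIV. p $ a * partial_deriv a (\<lambda>y. h (q, y, s)) p) - h (q, p, s))"
    proof clarify
      fix q p s assume m: "(q, p, s) \<in> M"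
      show "X (q, p, s) =
        (\<chi> a. partial_deriv a (\<lambda>y. h (q, y, s)) p,
         \<chi> a. - partial_deriv a (\<lambda>x. h (x, p, s)) q - p $ a * deriv (\<lambda>z. h (q, p, z)) s,
         (\<Sum>a\<in>UNIV. p $ a * partial_deriv a (\<lambda>y. h (q, y, s)) p) - h (q, p, s))"
        using key[OF m C] bspec[OF L m] C[OF m] by (simp add: prod_eq_iff inner_vec_def)
    qed
  next
    assume R: "\<forall>(q, p, s)\<in>M. X (q, p, s) =
      (\<chi> a. partial_deriv a (\<lambda>y. h (q, y, s)) p,
       \<chi> a. - partial_deriv a (\<lambda>x. h (x, p, s)) q - p $ a * deriv (\<lambda>z. h (q, p, z)) s,
       (\<Sum>a\<in>UNIV. p $ a * partial_deriv a (\<lambda>y. h (q, y, s)) p) - h (q, p, s))"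
    then have C: "snd (snd (X x)) = fst (snd x) \<bullet> fst (X x) - h x" if "x \<in> M" for x
      using that by (cases x) (auto simp: inner_vec_def)
    have "\<exists>r. \<forall>v. lie_derivative_form X contact_form x v = r * contact_form x v" if "x \<in> M" for x
    proof (cases x)
      case (fields q p s)
      then show ?thesis using key[OF _ C, of q p s] R that by auto
    qed
    then show "contact_hamiltonian_field M h X"
      unfolding contact_hamiltonian_field_def \<rho> \<iota> using C by blast
  qed
qed

lemma contact_hamilton_equations_iff_integral_curve:
  fixes H :: "real^'n::finite \<Rightarrow> real^'n \<Rightarrow> real \<Rightarrow> real \<Rightarrow> real"
  assumes M: "open M"
    and h: "\<And>x t. x \<in> M \<Longrightarrow> t \<in> J \<Longrightarrow> (\<lambda>(q, p, s). H q p s t) differentiable (at x)"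
    and X: "\<And>x t. x \<in> M \<Longrightarrow> t \<in> J \<Longrightarrow> X t differentiable (at x)"
    and field: "\<And>t. t \<in> J \<Longrightarrow> contact_hamiltonian_field M (\<lambda>(q, p, s). H q p s t) (X t)"
    and curve: "\<And>t. t \<in> J \<Longrightarrow> (q t, p t, s t) \<in> M"
  shows "contact_hamilton_equations J H q p s \<longleftrightarrow>
    (\<forall>t\<in>J. ((\<lambda>\<tau>. (q \<tau>, p \<tau>, s \<tau>)) has_vector_derivative X t (q t, p t, s t)) (at t))"
proof -
  have vec: "(y has_vector_derivative y') (at t) \<longleftrightarrow>
      (\<forall>a. ((\<lambda>\<tau>. y \<tau> $ a) has_real_derivative y' $ a) (at t))"
    for y :: "real \<Rightarrow> real^'n" and y' t
    unfolding has_vector_derivative_def has_field_derivative_def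
    by (subst has_derivative_componentwise_within)
       (simp add: Basis_vec_def inner_axis mult_commute_abs)
  have pair: "((\<lambda>\<tau>. (y \<tau>, z \<tau>)) has_vector_derivative (y', z')) (at t) \<longleftrightarrow>
      (y has_vector_derivative y') (at t) \<and> (z has_vector_derivative z') (at t)"
    for y :: "real \<Rightarrow> 'b::real_normed_vector" and z :: "real \<Rightarrow> 'c::real_normed_vector" and y' z' t
  proof
    assume "((\<lambda>\<tau>. (y \<tau>, z \<tau>)) has_vector_derivative (y', z')) (at t)"
    then show "(y has_vector_derivative y') (at t) \<and> (z has_vector_derivative z') (at t)"
      unfolding has_vector_derivative_def
      by (auto dest: has_derivative_fst has_derivative_snd)
  qed (auto intro: has_vector_derivative_Pair)
  have "X t (q t, p t, s t) =
      (\<chi> a. partial_deriv a (\<lambda>y. H (q t) y (s t) t) (p t),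
       \<chi> a. - partial_deriv a (\<lambda>x. H x (p t) (s t) t) (q t)
             - p t $ a * deriv (\<lambda>z. H (q t) (p t) z t) (s t),
       (\<Sum>a\<in>UNIV. p t $ a * partial_deriv a (\<lambda>y. H (q t) y (s t) t) (p t))
         - H (q t) (p t) (s t) t)" if "t \<in> J" for t
    using field[OF that] curve[OF that]
      contact_hamiltonian_field_iff[OF M h[OF _ that] X[OF _ that]] that by auto
  then show ?thesis
    unfolding contact_hamilton_equations_def
    by (simp add: pair vec has_real_derivative_iff_has_vector_derivative[of s])
qed

end

theory Submission
  imports Defs
begin

text \<open>
  For \<open>\<H> = |p|\<^sup>2 / 2 + V + f s\<close> the contact Hamiltonian equations read
  \<open>q' = p\<close>, \<open>p' = - \<nabla>V - f p\<close> and \<open>s' = |p|\<^sup>2 / 2 - V - f s\<close>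
  (\<open>damped_contact_equations_iff\<close>). The first two are the second-order system written as a
  first-order one: they force \<open>p = q'\<close>, and substituting this into the second equation gives
  \<open>q'' + \<nabla>V + f q' = 0\<close>. The variable \<open>s\<close> occurs in neither, because \<open>\<H>\<close> is affine in it.
  So a solution of the contact equations yields a solution of the second-order system by
  differentiating \<open>q' = p\<close>.

  Conversely, given \<open>q\<close>, put \<open>p = q'\<close>. What remains is to find \<open>s\<close> on all of \<open>J\<close>.
  Along the curve, the third equation is a scalar linear equation \<open>s' = l - f s\<close> whose
  inhomogeneity \<open>l = |p|\<^sup>2 / 2 - V\<close> is a function of \<open>t\<close> alone, so an integrating factor
  solves it globally (\<open>linear_ode_solution\<close>). The solution is smooth since the equation
  expresses \<open>s'\<close> through \<open>l\<close>, \<open>f\<close> and \<open>s\<close>: if \<open>s\<close> is \<open>C\<^sup>k\<close>, then so is \<open>s'\<close>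
  (\<open>smooth_on_linear_ode_solution\<close>). That \<open>l\<close> is smooth is where the chain rule for
  \<open>C\<^sup>k\<close> maps enters, for \<open>t \<mapsto> V (q t) t\<close> (\<open>C_on_compose\<close>).
\<close>

section \<open>Calculus of \<open>C\<^sup>k\<close> maps\<close>

text \<open>
  Openness of \<open>S\<close> is essential: the two-sided derivatives in \<open>C_on\<close> depend on the values in a
  full neighbourhood of each point of \<open>S\<close>.
\<close>

lemma C_on_cong:
  assumes "open S" and "\<And>x. x \<in> S \<Longrightarrow> f x = g x"
  shows "C_on k S f \<longleftrightarrow> C_on k S g"
  using assms(2)
proof (induction k arbitrary: f g)
  case 0
  then show ?case by (simp cong: continuous_on_cong)
next
  case (Suc k)
  have D: "(f has_derivative D) (at x) \<longleftrightarrow> (g has_derivative D) (at x)" if "x \<in> S" for x D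
    using Suc.prems that
    by (metis has_derivative_transform_within_open[OF _ assms(1)])
  have "f differentiable (at x) \<longleftrightarrow> g differentiable (at x)"
    "frechet_derivative f (at x) = frechet_derivative g (at x)" if "x \<in> S" for x
    using D[OF that] by (simp_all add: differentiable_def frechet_derivative_def)
  with Suc.IH[of "\<lambda>x. frechet_derivative f (at x) v" "\<lambda>x. frechet_derivative g (at x) v" for v]
  show ?case by simp
qed

text \<open>
  With this rule any formula for the derivative can replace \<open>frechet_derivative\<close>. Closure under
  products, pairs and composition then follows by induction on \<open>k\<close>: it suffices to write the
  derivative in terms of maps already known to be \<open>C\<^sup>k\<close>.
\<close>

lemma C_on_SucI:
  assumes "open S" and D: "\<And>x. x \<in> S \<Longrightarrow> (f has_derivative f' x) (at x)"
    and C: "\<And>v. C_on k S (\<lambda>x. f' x v)"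
  shows "C_on (Suc k) S f"
proof -
  have "C_on k S (\<lambda>x. frechet_derivative f (at x) v)" for v
    using C[of v] frechet_derivative_at[OF D] by (subst C_on_cong[OF assms(1)]) auto
  then show ?thesis using D by (auto simp: differentiable_def)
qed

lemma C_on_SucD: "C_on (Suc k) S f \<Longrightarrow> C_on k S f"
proof (induction k arbitrary: f)
  case 0
  then show ?case
    by (simp add: continuous_on_eq_continuous_within differentiable_imp_continuous_within
        differentiable_at_withinI)
next
  case (Suc k)
  then show ?case by (metis C_on.simps(2))
qed

lemma C_on_frechet:
  assumes "C_on (Suc k) S f" and "x \<in> S"
  shows "(f has_derivative frechet_derivative f (at x)) (at x)"
  using assms by (simp add: frechet_derivative_works)

lemma C_on_component_derivative:
  fixes y :: "real \<Rightarrow> real^'n::finite"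
  assumes "C_on 1 J y" and "t \<in> J"
  shows "((\<lambda>\<tau>. y \<tau> $ a) has_real_derivative frechet_derivative y (at t) 1 $ a) (at t)"
proof -
  have y: "(y has_derivative frechet_derivative y (at t)) (at t)"
    using C_on_frechet[of 0] assms by simp
  have "((\<lambda>\<tau>. y \<tau> $ a) has_derivative (\<lambda>v. frechet_derivative y (at t) v $ a)) (at t)"
    by (rule bounded_linear.has_derivative[OF bounded_linear_vec_nth y])
  moreover have "(\<lambda>v. frechet_derivative y (at t) v $ a) = (*) (frechet_derivative y (at t) 1 $ a)"
  proof
    fix v
    show "frechet_derivative y (at t) v $ a = frechet_derivative y (at t) 1 $ a * v"
      using linear_simps(5)[OF has_derivative_bounded_linear[OF y], of v 1]
      by (simp add: mult.commute)
  qed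
  ultimately show ?thesis
    by (simp add: has_field_derivative_def)
qed

lemma C_on_const: "open S \<Longrightarrow> C_on k S (\<lambda>x. c)"
proof (induction k arbitrary: c)
  case (Suc k)
  then show ?case by (intro C_on_SucI[where f' = "\<lambda>_ _. 0"]) auto
qed simp

lemma C_on_id: "open S \<Longrightarrow> C_on k S (\<lambda>x. x)"
proof (cases k)
  case (Suc m)
  assume "open S"
  then show ?thesis unfolding Suc
    by (intro C_on_SucI[where f' = "\<lambda>_ v. v"] C_on_const) (auto intro: has_derivative_ident)
qed simp

lemma C_on_add:
  assumes "open S"
  shows "C_on k S f \<Longrightarrow> C_on k S g \<Longrightarrow> C_on k S (\<lambda>x. f x + g x)"
proof (induction k arbitrary: f g)
  case (Suc k)
  show ?case
  proof (rule C_on_SucI[OF assms])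
    show "((\<lambda>x. f x + g x) has_derivative
        (\<lambda>v. frechet_derivative f (at x) v + frechet_derivative g (at x) v)) (at x)"
      if "x \<in> S" for x
      using Suc.prems that by (intro has_derivative_add C_on_frechet)
  qed (use Suc in simp)
qed (simp add: continuous_on_add)

lemma C_on_sum:
  assumes "open S" and "\<And>b. b \<in> B \<Longrightarrow> C_on k S (f b)"
  shows "C_on k S (\<lambda>x. \<Sum>b\<in>B. f b x)"
  using assms(2) by (induction B rule: infinite_finite_induct)
    (simp_all add: C_on_const C_on_add assms(1))

lemma C_on_bilinear:
  assumes "open S" and B: "bounded_bilinear B"
  shows "C_on k S f \<Longrightarrow> C_on k S g \<Longrightarrow> C_on k S (\<lambda>x. B (f x) (g x))"
proof (induction k arbitrary: f g)
  case 0
  then show ?case by (simp add: bounded_bilinear.continuous_on[OF B])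
next
  case (Suc k)
  show ?case
  proof (rule C_on_SucI[OF assms(1)])
    show "((\<lambda>x. B (f x) (g x)) has_derivative
        (\<lambda>v. B (f x) (frechet_derivative g (at x) v) + B (frechet_derivative f (at x) v) (g x)))
        (at x)" if "x \<in> S" for x
      using Suc.prems that by (intro bounded_bilinear.FDERIV[OF B] C_on_frechet)
  qed (use Suc.prems in \<open>auto intro!: C_on_add assms(1) Suc.IH dest: C_on_SucD simp del: C_on.simps,
      auto\<close>)
qed

lemma C_on_Pair:
  assumes "open S"
  shows "C_on k S f \<Longrightarrow> C_on k S g \<Longrightarrow> C_on k S (\<lambda>x. (f x, g x))"
proof (induction k arbitrary: f g)
  case (Suc k)
  show ?case
  proof (rule C_on_SucI[OF assms])
    show "((\<lambda>x. (f x, g x)) has_derivative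
        (\<lambda>v. (frechet_derivative f (at x) v, frechet_derivative g (at x) v))) (at x)"
      if "x \<in> S" for x
      using Suc.prems that by (intro has_derivative_Pair C_on_frechet)
  qed (use Suc in simp)
qed (simp add: continuous_on_Pair)

text \<open>
  The class \<open>C_on\<close> controls the derivative of \<open>h\<close> in each fixed direction only, whereas the chain
  rule evaluates it in the moving direction \<open>g' x v\<close>. Expanding that direction in a basis gives
  \<open>(h \<circ> g)' x v = (\<Sum>b\<in>Basis. (g' x v \<bullet> b) *\<^sub>R h' (g x) b)\<close>, where every \<open>\<lambda>y. h' y b\<close> is
  \<open>C\<^sup>k\<close> and the induction hypothesis applies to it; hence the finite dimension of the middle
  space.
\<close>

lemma C_on_compose:
  fixes g :: "'a::real_normed_vector \<Rightarrow> 'b::euclidean_space"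
    and h :: "'b \<Rightarrow> 'c::real_normed_vector"
  assumes "open S" and "g ` S \<subseteq> T"
  shows "C_on k S g \<Longrightarrow> C_on k T h \<Longrightarrow> C_on k S (\<lambda>x. h (g x))"
proof (induction k arbitrary: h)
  case 0
  then show ?case using assms(2) by (auto intro: continuous_on_compose2)
next
  case (Suc k)
  let ?g' = "\<lambda>x. frechet_derivative g (at x)" and ?h' = "\<lambda>x. frechet_derivative h (at (g x))"
  show ?case
  proof (rule C_on_SucI[OF assms(1)])
    fix x assume x: "x \<in> S"
    have g: "(g has_derivative ?g' x) (at x)" and h: "(h has_derivative ?h' x) (at (g x))"
      using Suc.prems x assms(2) by (auto intro!: C_on_frechet simp del: C_on.simps)
    interpret h: bounded_linear "?h' x" using h by (rule has_derivative_bounded_linear)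
    have "?h' x (?g' x v) = (\<Sum>b\<in>Basis. (?g' x v \<bullet> b) *\<^sub>R ?h' x b)" for v
      by (subst euclidean_representation[of "?g' x v", symmetric])
        (simp only: h.sum h.scaleR)
    with diff_chain_at[OF g h]
    show "((\<lambda>x. h (g x)) has_derivative (\<lambda>v. \<Sum>b\<in>Basis. (?g' x v \<bullet> b) *\<^sub>R ?h' x b)) (at x)"
      by (simp add: o_def)
  next
    fix v
    show "C_on k S (\<lambda>x. \<Sum>b\<in>Basis. (?g' x v \<bullet> b) *\<^sub>R ?h' x b)"
    proof (intro C_on_sum C_on_bilinear[OF _ bounded_bilinear_scaleR]
        C_on_bilinear[OF _ bounded_bilinear_inner] C_on_const assms(1))
      fix b :: 'b
      show "C_on k S (\<lambda>x. ?g' x v)" using Suc.prems(1) by simp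
      show "C_on k S (\<lambda>x. ?h' x b)"
        using Suc.IH[OF C_on_SucD[OF Suc.prems(1)],
            of "\<lambda>y. frechet_derivative h (at y) b"] Suc.prems(2) by simp
    qed
  qed
qed

section \<open>Linear scalar differential equations\<close>

text \<open>
  The interval may be unbounded, so its end points are taken in the extended reals.
\<close>

lemma antiderivative_on_open_interval:
  fixes g :: "real \<Rightarrow> real"
  assumes "open J" and "is_interval J" and "continuous_on J g"
  obtains G where "\<And>t. t \<in> J \<Longrightarrow> (G has_real_derivative g t) (at t)"
proof (cases "J = {}")
  case False
  define a b where "a = Inf (ereal ` J)" and "b = Sup (ereal ` J)"
  have in_ab: "a < ereal t \<and> ereal t < b" if t: "t \<in> J" for t
  proof -
    obtain e where e: "e > 0" "ball t e \<subseteq> J" using assms(1) t by (meson openE)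
    then have "t - e / 2 \<in> J" "t + e / 2 \<in> J" by (auto simp: dist_real_def subset_iff)
    then have "a \<le> ereal (t - e / 2)" "ereal (t + e / 2) \<le> b"
      unfolding a_def b_def by (auto intro: Inf_lower Sup_upper)
    moreover have "ereal (t - e / 2) < ereal t" "ereal t < ereal (t + e / 2)"
      using \<open>e > 0\<close> by simp_all
    ultimately show ?thesis by (meson order.strict_trans1 order.strict_trans2)
  qed
  have in_J: "t \<in> J" if t: "a < ereal t" "ereal t < b" for t
  proof -
    obtain x y where "x \<in> J" "x < t" "y \<in> J" "t < y"
      using t unfolding a_def b_def Inf_less_iff less_Sup_iff by auto
    then show ?thesis
      using assms(2) unfolding is_interval_1 by (meson less_imp_le)
  qed
  have "a < b" using in_ab False by (meson ex_in_conv order.strict_trans)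
  moreover have "isCont g t" if "a < ereal t" "ereal t < b" for t
    using assms(1,3) in_J[OF that] by (simp add: continuous_on_eq_continuous_at)
  ultimately obtain G where
    "\<forall>t. a < ereal t \<longrightarrow> ereal t < b \<longrightarrow> (G has_vector_derivative g t) (at t)"
    using einterval_antiderivative[of a b g] by auto
  then show thesis
    using in_ab that has_real_derivative_iff_has_vector_derivative by blast
qed (use that in blast)

text \<open>
  Variation of constants: with \<open>F' = f\<close> and \<open>G' = exp F * l\<close>, the function
  \<open>exp (- F) * G\<close> is a solution. It exists on all of \<open>J\<close>.
\<close>

lemma linear_ode_solution:
  fixes f l :: "real \<Rightarrow> real"
  assumes J: "open J" "is_interval J" and "continuous_on J f" and l: "continuous_on J l"
  obtains s where "\<And>t. t \<in> J \<Longrightarrow> (s has_real_derivative l t - f t * s t) (at t)"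
proof -
  obtain F where F: "\<And>t. t \<in> J \<Longrightarrow> (F has_real_derivative f t) (at t)"
    using antiderivative_on_open_interval[OF J assms(3)] by blast
  have "continuous_on J F"
    by (rule DERIV_continuous_on) (rule has_field_derivative_at_within[OF F])
  then have "continuous_on J (\<lambda>t. exp (F t) * l t)" by (intro continuous_intros l)
  then obtain G where G: "\<And>t. t \<in> J \<Longrightarrow> (G has_real_derivative exp (F t) * l t) (at t)"
    using antiderivative_on_open_interval[OF J] by blast
  show thesis
  proof (rule that[of "\<lambda>t. exp (- F t) * G t"])
    fix t assume t: "t \<in> J"
    have "((\<lambda>t. exp (- F t) * G t) has_real_derivative
        exp (- F t) * (- f t) * G t + exp (F t) * l t * exp (- F t)) (at t)"
      by (intro DERIV_mult DERIV_fun_exp DERIV_minus F G t)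
    then show "((\<lambda>t. exp (- F t) * G t) has_real_derivative
        l t - f t * (exp (- F t) * G t)) (at t)"
      by (simp add: exp_minus field_simps)
  qed
qed

text \<open>
  Bootstrapping: the equation makes \<open>s'\<close> as regular as \<open>s\<close> itself, so each \<open>C\<^sup>k\<close> bound on
  \<open>s\<close> improves to \<open>C\<^sup>k\<^sup>+\<^sup>1\<close>.
\<close>

lemma smooth_on_linear_ode_solution:
  fixes f l s :: "real \<Rightarrow> real"
  assumes "open J" and s: "\<And>t. t \<in> J \<Longrightarrow> (s has_real_derivative l t - f t * s t) (at t)"
    and f: "smooth_on J f" and l: "smooth_on J l"
  shows "smooth_on J s"
  unfolding smooth_on_def
proof
  fix k show "C_on k J s"
  proof (induction k)
    case 0
    then show ?case
      by (simp, rule DERIV_continuous_on) (rule has_field_derivative_at_within[OF s])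
  next
    case (Suc k)
    note mult = C_on_bilinear[OF assms(1) bounded_bilinear_mult]
    have "C_on k J (\<lambda>t. (l t + (- 1) * (f t * s t)) * v)" for v
      using f l by (intro mult C_on_add C_on_const assms(1) Suc.IH) (auto simp: smooth_on_def)
    then show ?case
      using s by (intro C_on_SucI[OF assms(1),
            where f' = "\<lambda>t v. (l t + (- 1) * (f t * s t)) * v"])
        (auto simp: has_field_derivative_def)
  qed
qed

section \<open>The equations of a damped mechanical system\<close>

text \<open>
  Adding constants does not change which numbers are derivatives of \<open>g\<close> at \<open>x\<close>, so \<open>deriv\<close>,
  which chooses such a number, makes the same choice.
\<close>

lemma deriv_add_consts: "deriv (\<lambda>h. c + g h + d) x = (deriv g x :: real)"
proof -
  have "((\<lambda>h. c + g h + d) has_real_derivative D) (at x) \<longleftrightarrow>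
      (g has_real_derivative D) (at x)" for D
  proof
    assume "((\<lambda>h. c + g h + d) has_real_derivative D) (at x)"
    then have "((\<lambda>h. (c + g h + d) - (c + d)) has_real_derivative D - 0) (at x)"
      by (intro DERIV_diff DERIV_const)
    then show "(g has_real_derivative D) (at x)" by simp
  qed (auto intro!: derivative_eq_intros)
  then show ?thesis by (simp add: deriv_def)
qed

text \<open>
  The kinetic energy has gradient \<open>p\<close>, which gives \<open>q' = p\<close>; it also enters \<open>s'\<close> once as
  \<open>p \<bullet> p\<close> and once, inside \<open>\<H>\<close>, as \<open>- p \<bullet> p / 2\<close>, leaving \<open>p \<bullet> p / 2\<close>. The damping term
  \<open>- f p\<close> is \<open>- p \<partial>\<H>/\<partial>s\<close>.
\<close>

lemma damped_contact_equations_iff: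
  "contact_hamilton_equations J
      (\<lambda>x y z t. (\<Sum>a\<in>UNIV. (y $ a)\<^sup>2 / 2) + V x t + f t * z) q p s \<longleftrightarrow>
   (\<forall>t\<in>J. (\<forall>a. ((\<lambda>\<tau>. q \<tau> $ a) has_real_derivative p t $ a) (at t)) \<and>
      (\<forall>a. ((\<lambda>\<tau>. p \<tau> $ a) has_real_derivative
             - partial_deriv a (\<lambda>x. V x t) (q t) - f t * p t $ a) (at t)) \<and>
      (s has_real_derivative (p t \<bullet> p t / 2 - V (q t) t) - f t * s t) (at t))"
proof -
  have kin: "(\<Sum>a\<in>UNIV. (y $ a)\<^sup>2 / 2) = y \<bullet> y / 2" for y :: "real^'n"
    by (simp add: inner_vec_def power2_eq_square sum_divide_distrib)
  have p: "partial_deriv a (\<lambda>y. y \<bullet> y / 2 + c + d) y = y $ a" for a c d and y :: "real^'n"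
  proof -
    have "((\<lambda>y. y \<bullet> y / 2 + c + d) has_derivative (\<lambda>v. y \<bullet> v)) (at y)"
      by (auto intro!: derivative_eq_intros simp: inner_commute)
    from deriv_along[OF this] show ?thesis by (simp add: partial_deriv_def inner_axis)
  qed
  have q: "partial_deriv a (\<lambda>x. c + W x + d) x = partial_deriv a W x" for a c d W x
    by (simp add: partial_deriv_def deriv_add_consts)
  have s: "deriv (\<lambda>z. c + d + m * z) z = m" for c d m z :: real
    by (intro DERIV_imp_deriv) (auto intro!: derivative_eq_intros)
  have E: "(\<Sum>a\<in>UNIV. p t $ a * p t $ a) - (p t \<bullet> p t / 2 + V (q t) t + f t * s t)
      = (p t \<bullet> p t / 2 - V (q t) t) - f t * s t" for t
    by (simp add: inner_vec_def)
  show ?thesis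
    by (simp add: contact_hamilton_equations_def kin p q s E mult.commute[of "p _ $ _" "f _"])
qed

theorem proposition3:
  fixes U :: "(real^'n::finite) set" and I J :: "real set"
    and V :: "real^'n \<Rightarrow> real \<Rightarrow> real" and f :: "real \<Rightarrow> real"
    and q :: "real \<Rightarrow> real^'n"
  assumes "open U"
    and "open I" and "is_interval I"
    and "smooth_on (U \<times> I) (\<lambda>(x, t). V x t)"
    and "smooth_on I f"
    and "open J" and "is_interval J" and "J \<subseteq> I"
    and "smooth_on J q" and "q ` J \<subseteq> U"
  shows "(\<forall>t\<in>J. \<forall>a. deriv (deriv (\<lambda>\<tau>. q \<tau> $ a)) t + partial_deriv a (\<lambda>x. V x t) (q t)
              + f t * deriv (\<lambda>\<tau>. q \<tau> $ a) t = 0)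
    \<longleftrightarrow>
    (\<exists>(p :: real \<Rightarrow> real^'n) (s :: real \<Rightarrow> real).
       smooth_on J p \<and> smooth_on J s \<and>
       contact_hamilton_equations J
         (\<lambda>x y z t. (\<Sum>a\<in>UNIV. (y $ a)\<^sup>2 / 2) + V x t + f t * z) q p s)"
    (is "?newton \<longleftrightarrow> ?contact")
proof -
  \<comment> \<open>The equation \<open>q' = p\<close> holds on the open set \<open>J\<close>, not just at \<open>t\<close>, so it may be
    differentiated.\<close>
  have second: "deriv (deriv (\<lambda>\<tau>. q \<tau> $ a)) t = deriv (\<lambda>\<tau>. p \<tau> $ a) t"
    if "\<And>t. t \<in> J \<Longrightarrow> ((\<lambda>\<tau>. q \<tau> $ a) has_real_derivative p t $ a) (at t)" and "t \<in> J"
    for p :: "real \<Rightarrow> real^'n" and a t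
  proof (rule deriv_cong_ev[OF _ refl])
    show "eventually (\<lambda>t. deriv (\<lambda>\<tau>. q \<tau> $ a) t = p t $ a) (nhds t)"
      using eventually_nhds_in_open[OF assms(6) that(2)]
      by (rule eventually_mono) (rule DERIV_imp_deriv[OF that(1)])
  qed
  show ?thesis
  proof
    assume ?contact
    then obtain p s where "contact_hamilton_equations J
         (\<lambda>x y z t. (\<Sum>a\<in>UNIV. (y $ a)\<^sup>2 / 2) + V x t + f t * z) q p s" by blast
    then have q': "\<And>t a. t \<in> J \<Longrightarrow> ((\<lambda>\<tau>. q \<tau> $ a) has_real_derivative p t $ a) (at t)"
      and p': "\<And>t a. t \<in> J \<Longrightarrow> ((\<lambda>\<tau>. p \<tau> $ a) has_real_derivative
             - partial_deriv a (\<lambda>x. V x t) (q t) - f t * p t $ a) (at t)"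
      unfolding damped_contact_equations_iff by auto
    show ?newton
      using second[OF q'] DERIV_imp_deriv[OF q'] DERIV_imp_deriv[OF p'] by simp
  next
    assume newton: ?newton
    define p where "p t = frechet_derivative q (at t) 1" for t
    have q_k: "C_on k J q" for k using assms(9) by (simp add: smooth_on_def)
    have p_k: "C_on k J p" for k unfolding p_def using q_k[of "Suc k"] by simp
    have q': "((\<lambda>\<tau>. q \<tau> $ a) has_real_derivative p t $ a) (at t)" if "t \<in> J" for t a
      using C_on_component_derivative[OF q_k that] by (simp add: p_def)
    have p': "((\<lambda>\<tau>. p \<tau> $ a) has_real_derivative
        - partial_deriv a (\<lambda>x. V x t) (q t) - f t * p t $ a) (at t)" if t: "t \<in> J" for t a
    proof -
      have "deriv (\<lambda>\<tau>. p \<tau> $ a) t = - partial_deriv a (\<lambda>x. V x t) (q t) - f t * p t $ a"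
        using newton[rule_format, OF t, of a] second[OF q' t, of a]
          DERIV_imp_deriv[OF q'[OF t, of a]] by simp
      then show ?thesis
        using C_on_component_derivative[OF p_k t, of a] DERIV_imp_deriv[OF C_on_component_derivative[OF p_k t, of a]] by simp
    qed
    have f_J: "smooth_on J f"
      unfolding smooth_on_def
      using C_on_compose[OF assms(6), of "\<lambda>t. t" I _ f] C_on_id[OF assms(6)] assms(5,8)
      by (auto simp: smooth_on_def)
    have V_J: "C_on k J (\<lambda>t. V (q t) t)" for k
    proof -
      have "(\<lambda>t. (q t, t)) ` J \<subseteq> U \<times> I" using assms(8,10) by auto
      from C_on_compose[OF assms(6) this C_on_Pair[OF assms(6) q_k C_on_id[OF assms(6)]],
          of k "\<lambda>(x, t). V x t"] assms(4)
      show ?thesis by (simp add: smooth_on_def)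
    qed
    have l: "smooth_on J (\<lambda>t. p t \<bullet> p t / 2 - V (q t) t)"
      unfolding smooth_on_def
    proof
      fix k
      \<comment> \<open>written with sums and products only, to fit the closure properties\<close>
      have "C_on k J (\<lambda>t. (p t \<bullet> p t) * (1 / 2) + (- 1) * V (q t) t)"
        by (intro C_on_add C_on_bilinear[OF _ bounded_bilinear_mult]
            C_on_bilinear[OF _ bounded_bilinear_inner] C_on_const p_k V_J assms(6))
      then show "C_on k J (\<lambda>t. p t \<bullet> p t / 2 - V (q t) t)" by simp
    qed
    have "continuous_on J f" "continuous_on J (\<lambda>t. p t \<bullet> p t / 2 - V (q t) t)"
      using f_J l unfolding smooth_on_def by (metis C_on.simps(1))+
    from linear_ode_solution[OF assms(6,7) this] obtain s where
      s': "\<And>t. t \<in> J \<Longrightarrow>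
        (s has_real_derivative (p t \<bullet> p t / 2 - V (q t) t) - f t * s t) (at t)" by blast
    then have "smooth_on J s"
      by (rule smooth_on_linear_ode_solution[OF assms(6) _ f_J l])
    moreover have "smooth_on J p" using p_k by (simp add: smooth_on_def)
    ultimately show ?contact
      unfolding damped_contact_equations_iff using q' p' s'
      by (intro exI[of _ p] exI[of _ s]) simp
  qed
qed

end
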